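(* Let $(M,\star)$ be an ordered monoid with partial order $\prec$. Equip, for each $n\ge 1$, the component $\mathbb{W}_M^{sh}(n)=M^n$ of the shuffle word operad of $M$ with the lexicographic order of tuples induced by $\prec$. Then $\mathbb{W}_M^{sh}$ is an ordered shuffle operad.
   Context: Orders are denoted by strict relations $\prec$. **Ordered monoid.** A monoid $(M,\star)$ equipped with a partial order $\prec$ such that $a\prec a'$ implies $a\star b\prec a'\star b$ and $b\star a\prec b\star a'$ for all $a,a',b\in M$. **Word operad.** For a monoid $(M,\star)$, the species $\mathbb{W}_M$ is defined by $\mathbb{W}_M(I)=M^I$ for each finite set $I$ (the set of functions $I\to M$). Let $\underline{n}=\{1,\dots,n\}$. For each map $f\colon I\to\underline{n}$ there is a map $$\gamma_f\colon \mathbb{W}_M(\underline{n})\times\mathbb{W}_M(f^{-1}(1))\times\cdots\times\mathbb{W}_M(f^{-1}(n))\to\mathbb{W}_M(I),\qquad \gamma_f(a;b_1,\ldots,b_n)(i):=a(f(i))\star b_{f(i)}(i).$$ These maps make $\mathbb{W}_M$ into a symmetric operad in $(\mathsf{Set},\times)$, the word operad of $M$. **Shuffle word operad.** $\mathbb{W}_M^{sh}$ is the shuffle operad associated to $\mathbb{W}_M$. Its components are $\mathbb{W}_M^{sh}(n)=M^n$ for $n\ge1$. Its structure maps are the maps $\gamma_f$ for shuffle surjections $f\colon\underline{m}\to\underline{n}$, i.e. surjections satisfying $\min f^{-1}(1)<\min f^{-1}(2)<\cdots<\min f^{-1}(n)$, where each $f^{-1}(j)$ is identified with $\underline{|f^{-1}(j)|}$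 via the unique order-preserving bijection. Such surjections correspond to two-level shuffle trees. **Lexicographic order of tuples.** $(a_1,\dots,a_n)\prec(a_1',\dots,a_n')$ if there is $j$ such that $a_i=a_i'$ for all $i<j$ and $a_j\prec a_j'$. **Ordered shuffle operad.** A shuffle operad $\mathcal{O}$ in sets is ordered if each component $\mathcal{O}(n)$ is equipped with a partial order $\prec$ for which every structure map $\mu_T(-;-,\ldots,-)$ ($T$ a two-level shuffle tree) is an increasing function of its arguments: if one of the arguments is replaced by an element of the same component of $\mathcal{O}$ which is greater with respect to $\prec$ (the other arguments being unchanged), then the result is also greater with respect to $\prec$. *)

theory Defs
  imports "HOL-Algebra.Group" "HOL-Library.Infinite_Set"
begin

definition strict_partial_order_on :: "'a set \<Rightarrow> ('a \<Rightarrow> 'a \<Rightarrow> bool) \<Rightarrow> bool" where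
  "strict_partial_order_on A lt \<longleftrightarrow> irreflp_on A lt \<and> transp_on A lt"

locale ordered_monoid = monoid M for M (structure) +
  fixes lt :: "'a \<Rightarrow> 'a \<Rightarrow> bool" (infix "\<prec>" 50)
  assumes order: "strict_partial_order_on (carrier M) (\<prec>)"
    and mult_right_mono:
      "\<lbrakk>a \<in> carrier M; a' \<in> carrier M; b \<in> carrier M; a \<prec> a'\<rbrakk> \<Longrightarrow> a \<otimes> b \<prec> a' \<otimes> b"
    and mult_left_mono:
      "\<lbrakk>a \<in> carrier M; a' \<in> carrier M; b \<in> carrier M; a \<prec> a'\<rbrakk> \<Longrightarrow> b \<otimes> a \<prec> b \<otimes> a'"

definition fibre :: "nat \<Rightarrow> (nat \<Rightarrow> nat) \<Rightarrow> nat \<Rightarrow> nat set" where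
  "fibre m f j = {i \<in> {1..m}. f i = j}"

text \<open>Maps between finite sets are represented by extensional functions, so that
  two maps are equal as soon as they agree on the set \<open>{1..m}\<close>.\<close>

definition shuffle_surj :: "nat \<Rightarrow> nat \<Rightarrow> (nat \<Rightarrow> nat) \<Rightarrow> bool" where
  "shuffle_surj m n f \<longleftrightarrow>
     1 \<le> n \<and> f \<in> {1..m} \<rightarrow>\<^sub>E {1..n} \<and> f ` {1..m} = {1..n} \<and>
     strict_mono_on {1..n} (\<lambda>j. Min (fibre m f j))"

text \<open>For a finite set \<open>S\<close> of naturals, \<open>from_std S\<close> is the increasing bijection from
  \<open>{1..card S}\<close> to \<open>S\<close> and \<open>to_std S\<close> is its inverse. The shift by one is
  needed because \<open>enumerate\<close> counts from \<open>0\<close>.\<close>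

definition from_std :: "nat set \<Rightarrow> nat \<Rightarrow> nat" where
  "from_std S k = enumerate S (k - 1)"

definition to_std :: "nat set \<Rightarrow> nat \<Rightarrow> nat" where
  "to_std S = the_inv_into {1..card S} (from_std S)"

lemma strict_mono_on_from_std:
  assumes "finite S"
  shows "strict_mono_on {1..card S} (from_std S)"
  using assms by (auto simp: strict_mono_on_def from_std_def intro!: finite_enumerate_mono)

lemma bij_betw_from_std:
  assumes "finite S"
  shows "bij_betw (from_std S) {1..card S} S"
proof -
  have "bij_betw (\<lambda>k. k - 1) {1..card S} {..<card S}"
    by (rule bij_betwI[where g = Suc]) auto
  from bij_betw_trans[OF this finite_bij_enumerate[OF assms]] show ?thesis
    by (simp add: from_std_def[abs_def] comp_def)
qed

text \<open>If \<open>g\<close> is a shuffle surjection from \<open>{1..l}\<close> to \<open>{1..m}\<close> and \<open>f\<close> one from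
  \<open>{1..m}\<close> to \<open>{1..n}\<close>, then \<open>g\<close> maps the fibre of \<open>f \<circ> g\<close> over \<open>j\<close> to
  the fibre of \<open>f\<close> over \<open>j\<close>. The following is this restriction of \<open>g\<close>, with both
  fibres identified with initial segments.\<close>

definition fibre_map :: "nat \<Rightarrow> nat \<Rightarrow> (nat \<Rightarrow> nat) \<Rightarrow> (nat \<Rightarrow> nat) \<Rightarrow> nat \<Rightarrow> nat \<Rightarrow> nat" where
  "fibre_map l m g f j =
     (\<lambda>k\<in>{1..card (fibre l (compose {1..l} f g) j)}.
        to_std (fibre m f j) (g (from_std (fibre l (compose {1..l} f g) j) k)))"

text \<open>A shuffle operad in sets. The element \<open>\<mu> m n f a b\<close> is the value of the structure map of
  the two-level shuffle tree given by the shuffle surjection \<open>f\<close> from \<open>{1..m}\<close> to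
  \<open>{1..n}\<close>: \<open>a\<close> is placed at the root vertex and \<open>b j\<close> at the \<open>j\<close>-th vertex
  of the upper level.\<close>

locale shuffle_operad =
  fixes Op :: "nat \<Rightarrow> 'c set"
    and unit :: 'c
    and \<mu> :: "nat \<Rightarrow> nat \<Rightarrow> (nat \<Rightarrow> nat) \<Rightarrow> 'c \<Rightarrow> (nat \<Rightarrow> 'c) \<Rightarrow> 'c"
  assumes unit_closed: "unit \<in> Op 1"
    and \<mu>_closed:
      "\<lbrakk>shuffle_surj m n f; a \<in> Op n; b \<in> (\<Pi>\<^sub>E j\<in>{1..n}. Op (card (fibre m f j)))\<rbrakk>
        \<Longrightarrow> \<mu> m n f a b \<in> Op m"
    and unit_left:
      "\<lbrakk>1 \<le> m; x \<in> Op m\<rbrakk> \<Longrightarrow> \<mu> m 1 (\<lambda>i\<in>{1..m}. 1) unit (\<lambda>j\<in>{1..1}. x) = x"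
    and unit_right:
      "\<lbrakk>1 \<le> n; a \<in> Op n\<rbrakk> \<Longrightarrow> \<mu> n n (\<lambda>i\<in>{1..n}. i) a (\<lambda>j\<in>{1..n}. unit) = a"
    and assoc:
      "\<lbrakk>shuffle_surj m n f; shuffle_surj l m g; a \<in> Op n;
        b \<in> (\<Pi>\<^sub>E j\<in>{1..n}. Op (card (fibre m f j)));
        c \<in> (\<Pi>\<^sub>E i\<in>{1..m}. Op (card (fibre l g i)))\<rbrakk>
        \<Longrightarrow> \<mu> l m g (\<mu> m n f a b) c =
            \<mu> l n (compose {1..l} f g) a
              (\<lambda>j\<in>{1..n}.
                 \<mu> (card (fibre l (compose {1..l} f g) j)) (card (fibre m f j))
                   (fibre_map l m g f j) (b j)
                   (\<lambda>k\<in>{1..card (fibre m f j)}. c (from_std (fibre m f j) k)))"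

locale ordered_shuffle_operad = shuffle_operad Op unit \<mu>
  for Op :: "nat \<Rightarrow> 'c set"
    and unit :: 'c
    and \<mu> :: "nat \<Rightarrow> nat \<Rightarrow> (nat \<Rightarrow> nat) \<Rightarrow> 'c \<Rightarrow> (nat \<Rightarrow> 'c) \<Rightarrow> 'c" +
  fixes lt :: "nat \<Rightarrow> 'c \<Rightarrow> 'c \<Rightarrow> bool"
  assumes order: "1 \<le> n \<Longrightarrow> strict_partial_order_on (Op n) (lt n)"
    and \<mu>_mono_root:
      "\<lbrakk>shuffle_surj m n f; a \<in> Op n; a' \<in> Op n;
        b \<in> (\<Pi>\<^sub>E j\<in>{1..n}. Op (card (fibre m f j))); lt n a a'\<rbrakk>
        \<Longrightarrow> lt m (\<mu> m n f a b) (\<mu> m n f a' b)"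
    and \<mu>_mono_upper:
      "\<lbrakk>shuffle_surj m n f; a \<in> Op n;
        b \<in> (\<Pi>\<^sub>E j\<in>{1..n}. Op (card (fibre m f j)));
        j \<in> {1..n}; b' \<in> Op (card (fibre m f j)); lt (card (fibre m f j)) (b j) b'\<rbrakk>
        \<Longrightarrow> lt m (\<mu> m n f a b) (\<mu> m n f a (b(j := b')))"

definition words :: "('a, 'r) monoid_scheme \<Rightarrow> 'i set \<Rightarrow> ('i \<Rightarrow> 'a) set" where
  "words M I = I \<rightarrow>\<^sub>E carrier M"

definition word_comp ::
    "('a, 'r) monoid_scheme \<Rightarrow> 'i set \<Rightarrow> ('i \<Rightarrow> nat) \<Rightarrow> (nat \<Rightarrow> 'a) \<Rightarrow> (nat \<Rightarrow> 'i \<Rightarrow> 'a) \<Rightarrow> 'i \<Rightarrow> 'a" where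
  "word_comp M I f a b = (\<lambda>i\<in>I. a (f i) \<otimes>\<^bsub>M\<^esub> b (f i) i)"

definition sh_words :: "('a, 'r) monoid_scheme \<Rightarrow> nat \<Rightarrow> (nat \<Rightarrow> 'a) set" where
  "sh_words M n = words M {1..n}"

definition sh_word_unit :: "('a, 'r) monoid_scheme \<Rightarrow> nat \<Rightarrow> 'a" where
  "sh_word_unit M = (\<lambda>i\<in>{1..1}. \<one>\<^bsub>M\<^esub>)"

text \<open>The tuple \<open>b j\<close> is indexed by an initial segment and is transported to the fibre of
  \<open>f\<close> over \<open>j\<close> before \<open>word_comp\<close> is applied.\<close>

definition sh_word_comp ::
    "('a, 'r) monoid_scheme \<Rightarrow> nat \<Rightarrow> nat \<Rightarrow> (nat \<Rightarrow> nat) \<Rightarrow> (nat \<Rightarrow> 'a) \<Rightarrow> (nat \<Rightarrow> nat \<Rightarrow> 'a) \<Rightarrow> nat \<Rightarrow> 'a" where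
  "sh_word_comp M m n f a b =
     word_comp M {1..m} f a (\<lambda>j\<in>{1..n}. \<lambda>i\<in>fibre m f j. b j (to_std (fibre m f j) i))"

definition tuple_lex :: "('a \<Rightarrow> 'a \<Rightarrow> bool) \<Rightarrow> nat \<Rightarrow> (nat \<Rightarrow> 'a) \<Rightarrow> (nat \<Rightarrow> 'a) \<Rightarrow> bool" where
  "tuple_lex lt n a a' \<longleftrightarrow> (\<exists>j\<in>{1..n}. (\<forall>i\<in>{1..<j}. a i = a' i) \<and> lt (a j) (a' j))"

end

theory Submission
  imports Defs
begin

text \<open>The operad axioms hold letter by letter. The \<open>i\<close>-th letter of a composite is
  \<open>a (f i) \<otimes> b (f i) r\<close>, where \<open>r\<close> is the rank of \<open>i\<close> in its fibre, so the unit laws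
  and associativity come from those of the monoid as soon as the ranks on both sides agree. The
  rank is the number of smaller or equal elements (\<open>to_std_eq_card\<close>), hence invariant under
  increasing maps (\<open>to_std_image\<close>); this settles associativity, where the same letter is ranked
  in a fibre of \<open>g\<close> and in the corresponding fibre of a standardized restriction of \<open>g\<close>.

  For monotonicity, one locates the first letter of the result that changes. If the root word
  changes first at \<open>j\<close>, all letters over \<open>j\<close> change, and those over larger indices
  may change too. The shuffle condition says exactly that the least element of the fibre over \<open>j\<close>
  precedes the fibres over larger indices, so it is the first position that changes, and there the
  result increases by monotonicity of \<open>\<otimes>\<close> on the left argument. If the word at the \<open>j\<close>-th
  upper vertex changes first at \<open>p\<close>, then only letters in the fibre over \<open>j\<close> are affected, and
  because fibres are numbered increasingly, its \<open>p\<close>-th element is the first one that changes.\<close>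

section \<open>Ranks in finite sets of naturals\<close>

lemma to_std_from_std:
  assumes "finite S" "k \<in> {1..card S}"
  shows "to_std S (from_std S k) = k"
  using bij_betw_from_std[OF assms(1)] assms(2)
  by (simp add: to_std_def the_inv_into_f_f bij_betw_imp_inj_on)

lemma from_std_in:
  assumes "finite S" "k \<in> {1..card S}"
  shows "from_std S k \<in> S"
  using bij_betw_from_std[OF assms(1)] assms(2) by (rule bij_betw_apply)

lemma from_std_to_std:
  assumes "finite S" "x \<in> S"
  shows "from_std S (to_std S x) = x"
  using bij_betw_from_std[OF assms(1)] assms(2)
  by (simp add: to_std_def f_the_inv_into_f_bij_betw)

lemma to_std_in:
  assumes "finite S" "x \<in> S"
  shows "to_std S x \<in> {1..card S}"
  using bij_betw_the_inv_into[OF bij_betw_from_std[OF assms(1)]] assms(2)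
  unfolding to_std_def by (rule bij_betw_apply)

lemma from_std_le_iff:
  assumes "finite S" "k \<in> {1..card S}" "k' \<in> {1..card S}"
  shows "from_std S k \<le> from_std S k' \<longleftrightarrow> k \<le> k'"
  using strict_mono_on_less_eq[OF strict_mono_on_from_std[OF assms(1)]] assms(2,3) by blast

text \<open>Counting replaces the description of the rank through an enumeration by one
  that is easy to transport along increasing maps.\<close>

lemma to_std_eq_card:
  assumes "finite S" "x \<in> S"
  shows "to_std S x = card {y \<in> S. y \<le> x}"
proof -
  let ?k = "to_std S x"
  have k: "?k \<in> {1..card S}" using assms by (rule to_std_in)
  have "from_std S ` {1..?k} = {y \<in> S. y \<le> x}"
  proof (intro equalityI subsetI)
    fix y assume "y \<in> from_std S ` {1..?k}"
    then obtain k' where k': "k' \<in> {1..?k}" "y = from_std S k'" by blast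
    with k have "k' \<in> {1..card S}" by auto
    with k k' show "y \<in> {y \<in> S. y \<le> x}"
      using from_std_in[OF assms(1), of k'] from_std_le_iff[OF assms(1), of k' ?k]
        from_std_to_std[OF assms] by auto
  next
    fix y assume y: "y \<in> {y \<in> S. y \<le> x}"
    then have "to_std S y \<in> {1..card S}" using to_std_in[OF assms(1)] by blast
    with y k have "to_std S y \<in> {1..?k}"
      using from_std_le_iff[OF assms(1), of "to_std S y" ?k]
        from_std_to_std[OF assms(1)] assms(2) by auto
    then have "from_std S (to_std S y) \<in> from_std S ` {1..?k}" by (rule imageI)
    then show "y \<in> from_std S ` {1..?k}"
      using y from_std_to_std[OF assms(1), of y] by simp
  qed
  moreover have "inj_on (from_std S) {1..?k}"
    using bij_betw_imp_inj_on[OF bij_betw_from_std[OF assms(1)]]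
    by (rule inj_on_subset) (use k in auto)
  ultimately show ?thesis using card_image[of "from_std S" "{1..?k}"] by simp
qed

lemma to_std_image:
  assumes "finite A" "strict_mono_on A h" "x \<in> A"
  shows "to_std (h ` A) (h x) = to_std A x"
proof -
  have "{y \<in> h ` A. y \<le> h x} = h ` {y \<in> A. y \<le> x}"
    using strict_mono_on_less_eq[OF assms(2)] assms(3) by auto
  moreover have "inj_on h {y \<in> A. y \<le> x}"
    using strict_mono_on_imp_inj_on[OF assms(2)] by (rule inj_on_subset) auto
  ultimately show ?thesis using assms by (simp add: to_std_eq_card card_image)
qed

lemma to_std_interval:
  assumes "i \<in> {1..m}"
  shows "to_std {1..m} i = i"
proof -
  have "{y \<in> {1..m}. y \<le> i} = {1..i}" using assms by auto
  then show ?thesis using assms by (simp add: to_std_eq_card)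
qed

lemma to_std_singleton: "to_std {i} i = 1"
proof -
  have "{y \<in> {i}. y \<le> i} = {i}" by auto
  then show ?thesis by (simp add: to_std_eq_card)
qed

lemma to_std_less:
  assumes "finite S" "x \<in> S" "p \<in> {1..card S}" "x < from_std S p"
  shows "to_std S x < p"
  using from_std_le_iff[OF assms(1,3) to_std_in[OF assms(1,2)]] assms(4)
    from_std_to_std[OF assms(1,2)] by linarith

section \<open>Fibres\<close>

lemma finite_fibre: "finite (fibre m f j)"
  by (simp add: fibre_def)

lemma mem_fibre_iff: "i \<in> fibre m f j \<longleftrightarrow> i \<in> {1..m} \<and> f i = j"
  by (simp add: fibre_def)

lemma shuffle_surj_closed:
  assumes "shuffle_surj m n f" "i \<in> {1..m}"
  shows "f i \<in> {1..n}"
  using assms by (auto simp: shuffle_surj_def)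

lemma shuffle_surj_funcset: "shuffle_surj m n f \<Longrightarrow> f \<in> {1..m} \<rightarrow> {1..n}"
  using shuffle_surj_closed by blast

lemma Min_fibre_in:
  assumes "shuffle_surj m n f" "j \<in> {1..n}"
  shows "Min (fibre m f j) \<in> fibre m f j"
proof (rule Min_in[OF finite_fibre])
  have "j \<in> f ` {1..m}" using assms by (simp add: shuffle_surj_def)
  then show "fibre m f j \<noteq> {}" by (auto simp: fibre_def)
qed

text \<open>The only consequence of the shuffle condition that monotonicity needs. A position \<open>i\<close>
  bounds the minimum of its own fibre from above, and these minima increase with the index.\<close>

lemma less_Min_fibre_imp_less:
  assumes f: "shuffle_surj m n f" and j: "j \<in> {1..n}"
    and i: "i \<in> {1..m}" "i < Min (fibre m f j)"
  shows "f i < j"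
proof (rule ccontr)
  assume "\<not> f i < j"
  moreover have "strict_mono_on {1..n} (\<lambda>j. Min (fibre m f j))"
    using f by (simp add: shuffle_surj_def)
  ultimately have "Min (fibre m f j) \<le> Min (fibre m f (f i))"
    using strict_mono_on_less_eq[of "{1..n}" "\<lambda>j. Min (fibre m f j)" j "f i"]
      j shuffle_surj_closed[OF f i(1)] by simp
  also have "\<dots> \<le> i" using i(1) by (intro Min_le finite_fibre) (simp add: mem_fibre_iff)
  finally show False using i(2) by simp
qed

text \<open>The fibres of a standardized restriction of \<open>g\<close> correspond, through the increasing
  enumeration of the fibre of \<open>f \<circ> g\<close>, to fibres of \<open>g\<close>; therefore ranks agree.\<close>

lemma fibre_map_to_std:
  fixes l m :: nat and f g :: "nat \<Rightarrow> nat"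
  assumes g: "g \<in> {1..l} \<rightarrow> {1..m}" and i: "i \<in> {1..l}"
  defines "j \<equiv> f (g i)"
  defines "F \<equiv> fibre l (compose {1..l} f g) j"
  defines "h \<equiv> fibre_map l m g f j"
  shows "to_std F i \<in> {1..card F}"
    and "h (to_std F i) = to_std (fibre m f j) (g i)"
    and "to_std (fibre (card F) h (h (to_std F i))) (to_std F i) = to_std (fibre l g (g i)) i"
proof -
  let ?k = "to_std F i" and ?A = "fibre (card F) h (h (to_std F i))"
  have fin: "finite F" by (simp add: F_def finite_fibre)
  have F: "x \<in> F \<longleftrightarrow> x \<in> {1..l} \<and> f (g x) = j" for x
    by (auto simp: F_def mem_fibre_iff compose_def)
  have iF: "i \<in> F" using i by (simp add: F j_def)
  show k: "?k \<in> {1..card F}" using fin iF by (rule to_std_in)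
  have h: "h q = to_std (fibre m f j) (g (from_std F q))" if "q \<in> {1..card F}" for q
    using that by (simp add: h_def fibre_map_def F_def)
  show hk: "h ?k = to_std (fibre m f j) (g i)"
    using h[OF k] from_std_to_std[OF fin iF] by simp
  have g_in: "g x \<in> fibre m f j" if "x \<in> F" for x
    using that g by (auto simp: F mem_fibre_iff)
  \<comment> \<open>Ranking inside the fibre of \<open>f\<close> is injective, so \<open>h\<close> separates as much as \<open>g\<close>.\<close>
  have eq: "h q = h ?k \<longleftrightarrow> g (from_std F q) = g i" if q: "q \<in> {1..card F}" for q
    using h[OF q] hk from_std_to_std[OF finite_fibre g_in[OF from_std_in[OF fin q]]]
      from_std_to_std[OF finite_fibre g_in[OF iF]] by metis
  have img: "from_std F ` ?A = fibre l g (g i)"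
  proof (intro equalityI subsetI)
    fix x assume "x \<in> from_std F ` ?A"
    then obtain q where q: "q \<in> {1..card F}" "h q = h ?k" "x = from_std F q"
      by (auto simp: mem_fibre_iff)
    then show "x \<in> fibre l g (g i)"
      using eq[OF q(1)] from_std_in[OF fin q(1)] by (simp add: mem_fibre_iff F)
  next
    fix x assume x: "x \<in> fibre l g (g i)"
    then have xF: "x \<in> F" by (simp add: mem_fibre_iff F j_def)
    have "to_std F x \<in> ?A"
      using eq[OF to_std_in[OF fin xF]] to_std_in[OF fin xF] from_std_to_std[OF fin xF] x
      by (simp add: mem_fibre_iff)
    then show "x \<in> from_std F ` ?A"
      using from_std_to_std[OF fin xF] by (intro image_eqI[of _ _ "to_std F x"]) auto
  qed
  have "strict_mono_on ?A (from_std F)"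
    using strict_mono_on_from_std[OF fin] by (rule monotone_on_subset) (auto simp: mem_fibre_iff)
  from to_std_image[OF finite_fibre this, of ?k] img k from_std_to_std[OF fin iF]
  show "to_std ?A ?k = to_std (fibre l g (g i)) i"
    by (simp add: mem_fibre_iff)
qed

section \<open>The shuffle word operad\<close>

lemma sh_wordsD: "a \<in> sh_words M n \<Longrightarrow> i \<in> {1..n} \<Longrightarrow> a i \<in> carrier M"
  by (auto simp: sh_words_def words_def)

lemma sh_words_eqI:
  assumes "a \<in> sh_words M n" "a' \<in> sh_words M n" "\<And>i. i \<in> {1..n} \<Longrightarrow> a i = a' i"
  shows "a = a'"
  using assms unfolding sh_words_def words_def by (rule PiE_ext)

lemma sh_word_comp_apply:
  assumes "i \<in> {1..m}" "f i \<in> {1..n}"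
  shows "sh_word_comp M m n f a b i = a (f i) \<otimes>\<^bsub>M\<^esub> b (f i) (to_std (fibre m f (f i)) i)"
  using assms by (simp add: sh_word_comp_def word_comp_def mem_fibre_iff)

lemma sh_word_comp_outside:
  assumes "i \<notin> {1..m}"
  shows "sh_word_comp M m n f a b i = undefined"
  unfolding sh_word_comp_def word_comp_def
  by (rule extensional_arb[OF restrict_extensional assms])

lemma upper_letter_closed:
  assumes "b \<in> (\<Pi>\<^sub>E j\<in>{1..n}. sh_words M (card (fibre m f j)))" "i \<in> {1..m}" "f i \<in> {1..n}"
  shows "b (f i) (to_std (fibre m f (f i)) i) \<in> carrier M"
proof (rule sh_wordsD)
  show "b (f i) \<in> sh_words M (card (fibre m f (f i)))" using assms by auto
  show "to_std (fibre m f (f i)) i \<in> {1..card (fibre m f (f i))}"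
    using assms by (intro to_std_in finite_fibre) (simp add: mem_fibre_iff)
qed

lemma (in monoid) sh_word_comp_closed:
  assumes "f \<in> {1..m} \<rightarrow> {1..n}" "a \<in> sh_words G n"
    and "b \<in> (\<Pi>\<^sub>E j\<in>{1..n}. sh_words G (card (fibre m f j)))"
  shows "sh_word_comp G m n f a b \<in> sh_words G m"
proof -
  have "sh_word_comp G m n f a b i \<in> carrier G" if i: "i \<in> {1..m}" for i
  proof -
    have fi: "f i \<in> {1..n}" using assms(1) i by blast
    show ?thesis
      using sh_word_comp_apply[of i m f n G a b] i fi sh_wordsD[OF assms(2) fi]
        upper_letter_closed[OF assms(3) i fi] by simp
  qed
  then show ?thesis
    unfolding sh_words_def words_def using sh_word_comp_outside by (rule PiE_I)
qed

lemma (in monoid) sh_word_unit_closed: "sh_word_unit G \<in> sh_words G 1"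
  by (auto simp: sh_word_unit_def sh_words_def words_def)

lemma (in monoid) sh_word_unit_left:
  assumes x: "x \<in> sh_words G m"
  shows "sh_word_comp G m 1 (\<lambda>i\<in>{1..m}. 1) (sh_word_unit G) (\<lambda>j\<in>{1..1}. x) = x"
proof (rule sh_words_eqI[OF _ x])
  have fib: "fibre m (\<lambda>i\<in>{1..m}. 1) 1 = {1..m}" by (auto simp: fibre_def)
  have "(\<lambda>j\<in>{1..1}. x) \<in> (\<Pi>\<^sub>E j\<in>{1..1}. sh_words G (card (fibre m (\<lambda>i\<in>{1..m}. 1) j)))"
    using x fib by (simp add: PiE_iff)
  then show "sh_word_comp G m 1 (\<lambda>i\<in>{1..m}. 1) (sh_word_unit G) (\<lambda>j\<in>{1..1}. x) \<in> sh_words G m"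
    by (intro sh_word_comp_closed sh_word_unit_closed) auto
  fix i assume i: "i \<in> {1..m}"
  then show "sh_word_comp G m 1 (\<lambda>i\<in>{1..m}. 1) (sh_word_unit G) (\<lambda>j\<in>{1..1}. x) i = x i"
    using fib to_std_interval[OF i] sh_wordsD[OF x i]
    by (subst sh_word_comp_apply) (simp_all add: sh_word_unit_def)
qed

lemma (in monoid) sh_word_unit_right:
  assumes a: "a \<in> sh_words G n"
  shows "sh_word_comp G n n (\<lambda>i\<in>{1..n}. i) a (\<lambda>j\<in>{1..n}. sh_word_unit G) = a"
proof (rule sh_words_eqI[OF _ a])
  have fib: "fibre n (\<lambda>i\<in>{1..n}. i) i = {i}" if "i \<in> {1..n}" for i
    using that by (auto simp: fibre_def)
  have "(\<lambda>j\<in>{1..n}. sh_word_unit G) \<in>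
      (\<Pi>\<^sub>E j\<in>{1..n}. sh_words G (card (fibre n (\<lambda>i\<in>{1..n}. i) j)))"
    using fib sh_word_unit_closed by (simp add: PiE_iff)
  then show "sh_word_comp G n n (\<lambda>i\<in>{1..n}. i) a (\<lambda>j\<in>{1..n}. sh_word_unit G) \<in> sh_words G n"
    using a by (intro sh_word_comp_closed) auto
  fix i assume i: "i \<in> {1..n}"
  then show "sh_word_comp G n n (\<lambda>i\<in>{1..n}. i) a (\<lambda>j\<in>{1..n}. sh_word_unit G) i = a i"
    using fib[OF i] sh_wordsD[OF a i]
    by (subst sh_word_comp_apply) (simp_all add: sh_word_unit_def to_std_singleton)
qed

lemma (in monoid) sh_word_comp_assoc:
  assumes f: "f \<in> {1..m} \<rightarrow> {1..n}" and g: "g \<in> {1..l} \<rightarrow> {1..m}"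
    and a: "a \<in> sh_words G n"
    and b: "b \<in> (\<Pi>\<^sub>E j\<in>{1..n}. sh_words G (card (fibre m f j)))"
    and c: "c \<in> (\<Pi>\<^sub>E i\<in>{1..m}. sh_words G (card (fibre l g i)))"
  shows "sh_word_comp G l m g (sh_word_comp G m n f a b) c =
      sh_word_comp G l n (compose {1..l} f g) a
        (\<lambda>j\<in>{1..n}.
           sh_word_comp G (card (fibre l (compose {1..l} f g) j)) (card (fibre m f j))
             (fibre_map l m g f j) (b j)
             (\<lambda>k\<in>{1..card (fibre m f j)}. c (from_std (fibre m f j) k)))"
    (is "?L = sh_word_comp G l n ?fg a ?d")
proof
  fix i
  show "?L i = sh_word_comp G l n ?fg a ?d i"
  proof (cases "i \<in> {1..l}")
    case False
    then show ?thesis by (simp only: sh_word_comp_outside not_False_eq_True)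
  next
    case i: True
    let ?j = "f (g i)"
    let ?F = "fibre l ?fg ?j" and ?S = "fibre m f ?j" and ?h = "fibre_map l m g f ?j"
    let ?k = "to_std ?F i"
    let ?x = "a ?j" and ?y = "b ?j (to_std ?S (g i))" and ?z = "c (g i) (to_std (fibre l g (g i)) i)"
    have gi: "g i \<in> {1..m}" using g i by blast
    then have fgi: "?j \<in> {1..n}" using f by blast
    have giS: "g i \<in> ?S" using gi by (simp add: mem_fibre_iff)
    have closed: "?x \<in> carrier G" "?y \<in> carrier G" "?z \<in> carrier G"
      using sh_wordsD[OF a fgi] upper_letter_closed[OF b gi fgi] upper_letter_closed[OF c i gi]
      by simp_all
    have fg: "?fg i = ?j" using i by (simp add: compose_def)
    note k = fibre_map_to_std[OF g i, of f]
    have hk: "?h ?k \<in> {1..card ?S}" using k(2) to_std_in[OF finite_fibre giS] by simp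
    have "?d ?j ?k = ?y \<otimes> ?z"
      using sh_word_comp_apply[of ?k "card ?F" ?h "card ?S" G "b ?j"
          "\<lambda>k\<in>{1..card ?S}. c (from_std ?S k)", OF k(1) hk] fgi hk k(2,3) from_std_to_std[OF finite_fibre giS]
      by simp
    then have "sh_word_comp G l n ?fg a ?d i = ?x \<otimes> (?y \<otimes> ?z)"
      using sh_word_comp_apply[of i l ?fg n G a ?d] i fgi fg by simp
    moreover have "?L i = (?x \<otimes> ?y) \<otimes> ?z"
      by (simp add: sh_word_comp_apply[of i l g m, OF i gi]
          sh_word_comp_apply[of "g i" m f n, OF gi fgi])
    ultimately show ?thesis using closed by (simp add: m_assoc)
  qed
qed

lemma (in monoid) shuffle_operad_sh_words:
  "shuffle_operad (sh_words G) (sh_word_unit G) (sh_word_comp G)"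
proof
  show "sh_word_unit G \<in> sh_words G 1" by (rule sh_word_unit_closed)
  show "sh_word_comp G m n f a b \<in> sh_words G m"
    if "shuffle_surj m n f" "a \<in> sh_words G n"
      "b \<in> (\<Pi>\<^sub>E j\<in>{1..n}. sh_words G (card (fibre m f j)))" for m n f a b
    using sh_word_comp_closed[OF shuffle_surj_funcset[OF that(1)] that(2,3)] .
qed (rule sh_word_unit_left sh_word_unit_right sh_word_comp_assoc;
     (rule shuffle_surj_funcset)?; assumption)+

section \<open>Monotonicity of composition\<close>

lemma strict_partial_order_tuple_lex:
  assumes "strict_partial_order_on (carrier M) lt"
  shows "strict_partial_order_on (sh_words M n) (tuple_lex lt n)"
  unfolding strict_partial_order_on_def
proof (intro conjI irreflp_onI transp_onI)
  fix a assume "a \<in> sh_words M n"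
  then show "\<not> tuple_lex lt n a a"
    using assms sh_wordsD[of a M n]
    by (auto simp: tuple_lex_def strict_partial_order_on_def irreflp_on_def)
next
  fix a b c
  assume words: "a \<in> sh_words M n" "b \<in> sh_words M n" "c \<in> sh_words M n"
    and "tuple_lex lt n a b" "tuple_lex lt n b c"
  then obtain p q where p: "p \<in> {1..n}" "\<forall>i\<in>{1..<p}. a i = b i" "lt (a p) (b p)"
    and q: "q \<in> {1..n}" "\<forall>i\<in>{1..<q}. b i = c i" "lt (b q) (c q)"
    by (auto simp: tuple_lex_def)
  \<comment> \<open>The first change from \<open>a\<close> to \<open>c\<close> is the earlier of the two changes; transitivity of \<open>lt\<close>
    enters only when they coincide.\<close>
  have "lt (a (min p q)) (c (min p q))"
  proof (cases p q rule: linorder_cases)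
    case less
    then show ?thesis using p q by auto
  next
    case equal
    have trans: "transp_on (carrier M) lt"
      using assms by (simp add: strict_partial_order_on_def)
    have "lt (a p) (c p)"
      using transp_onD[OF trans words[THEN sh_wordsD, OF p(1)] p(3)] q(3) equal by simp
    with equal show ?thesis by simp
  next
    case greater
    then show ?thesis using p q by auto
  qed
  then show "tuple_lex lt n a c"
    unfolding tuple_lex_def using p q by (intro bexI[of _ "min p q"]) auto
qed

context ordered_monoid
begin

text \<open>For a surjection that is not a shuffle this fails: a letter over an index larger than
  \<open>j\<close>, where the root word may have changed in any direction, could come first.\<close>

lemma sh_word_comp_mono_root:
  assumes f: "shuffle_surj m n f"
    and a: "a \<in> sh_words M n" and a': "a' \<in> sh_words M n"
    and b: "b \<in> (\<Pi>\<^sub>E j\<in>{1..n}. sh_words M (card (fibre m f j)))"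
    and less: "tuple_lex (\<prec>) n a a'"
  shows "tuple_lex (\<prec>) m (sh_word_comp M m n f a b) (sh_word_comp M m n f a' b)"
proof -
  obtain j where j: "j \<in> {1..n}" "\<forall>i\<in>{1..<j}. a i = a' i" "a j \<prec> a' j"
    using less by (auto simp: tuple_lex_def)
  let ?i = "Min (fibre m f j)"
  have i: "?i \<in> {1..m}" "f ?i = j"
    using Min_fibre_in[OF f j(1)] by (simp_all add: mem_fibre_iff)
  note app = sh_word_comp_apply[where f = f, OF _ shuffle_surj_closed[OF f]]
  have "sh_word_comp M m n f a b i' = sh_word_comp M m n f a' b i'" if "i' \<in> {1..<?i}" for i'
  proof -
    have i': "i' \<in> {1..m}" using that i by auto
    then have "f i' \<in> {1..<j}"
      using less_Min_fibre_imp_less[OF f j(1) i'] shuffle_surj_closed[OF f i'] that by simp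
    then show ?thesis using j(2) by (simp add: app[OF i' i'])
  qed
  moreover have "sh_word_comp M m n f a b ?i \<prec> sh_word_comp M m n f a' b ?i"
    using i(2) j mult_right_mono sh_wordsD[OF a j(1)] sh_wordsD[OF a' j(1)]
      upper_letter_closed[OF b i(1) shuffle_surj_closed[OF f i(1)]]
    by (simp add: app[OF i(1) i(1)])
  ultimately show ?thesis unfolding tuple_lex_def using i(1) by blast
qed

text \<open>Here only the increasing identification of a fibre with an initial segment matters: it
  turns the first change at the upper vertex into the first change of the result.\<close>

lemma sh_word_comp_mono_upper:
  assumes f: "shuffle_surj m n f" and a: "a \<in> sh_words M n"
    and b: "b \<in> (\<Pi>\<^sub>E j\<in>{1..n}. sh_words M (card (fibre m f j)))"
    and j: "j \<in> {1..n}" and b': "b' \<in> sh_words M (card (fibre m f j))"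
    and less: "tuple_lex (\<prec>) (card (fibre m f j)) (b j) b'"
  shows "tuple_lex (\<prec>) m (sh_word_comp M m n f a b) (sh_word_comp M m n f a (b(j := b')))"
proof -
  let ?S = "fibre m f j"
  obtain p where p: "p \<in> {1..card ?S}" "\<forall>q\<in>{1..<p}. b j q = b' q" "b j p \<prec> b' p"
    using less by (auto simp: tuple_lex_def)
  let ?i = "from_std ?S p"
  have i: "?i \<in> {1..m}" "f ?i = j"
    using from_std_in[OF finite_fibre p(1)] by (simp_all add: mem_fibre_iff)
  note app = sh_word_comp_apply[where f = f, OF _ shuffle_surj_closed[OF f]]
  have "sh_word_comp M m n f a b i' = sh_word_comp M m n f a (b(j := b')) i'"
    if "i' \<in> {1..<?i}" for i'
  proof -
    have i': "i' \<in> {1..m}" using that i by auto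
    show ?thesis
    proof (cases "f i' = j")
      case True
      then have i'S: "i' \<in> ?S" using i' by (simp add: mem_fibre_iff)
      have "to_std ?S i' \<in> {1..<p}"
        using to_std_less[OF finite_fibre i'S p(1)] to_std_in[OF finite_fibre i'S] that by simp
      then show ?thesis using p(2) True by (simp add: app[OF i' i'])
    qed (simp add: app[OF i' i'])
  qed
  moreover have "sh_word_comp M m n f a b ?i \<prec> sh_word_comp M m n f a (b(j := b')) ?i"
  proof -
    have "b j \<in> sh_words M (card ?S)" using b j by auto
    then show ?thesis
      using i(2) p to_std_from_std[OF finite_fibre p(1)] mult_left_mono
        sh_wordsD[OF a j] sh_wordsD[OF _ p(1), of _ M] b' by (simp add: app[OF i(1) i(1)])
  qed
  ultimately show ?thesis unfolding tuple_lex_def using i(1) by blast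
qed

end

theorem proposition1p6:
  fixes M :: "('a, 'r) monoid_scheme"
    and lt :: "'a \<Rightarrow> 'a \<Rightarrow> bool"
  assumes "ordered_monoid M lt"
  shows "ordered_shuffle_operad (sh_words M) (sh_word_unit M) (sh_word_comp M) (tuple_lex lt)"
proof -
  interpret ordered_monoid M lt by (rule assms)
  interpret shuffle_operad "sh_words M" "sh_word_unit M" "sh_word_comp M"
    by (rule shuffle_operad_sh_words)
  show ?thesis
    by unfold_locales
      (rule strict_partial_order_tuple_lex[OF order] sh_word_comp_mono_root
        sh_word_comp_mono_upper; assumption)+
qed

end
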